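(* Let $(R,\mathfrak{m})$ be a reduced one-dimensional noetherian local commutative ring whose normalization $\widetilde R$ is a finitely generated $R$-module, and let $\mathcal{C}$ be the conductor of $R$. Then $\mathcal{C}\supseteq \mathfrak{m}$ if and only if $R$ is $1$-step normal.
   Context: Let $Q(R)$ be the total ring of fractions of $R$. The normalization $\widetilde R$ is the integral closure of $R$ in $Q(R)$. The conductor of $R$ is $\mathcal{C}=\{a\in Q(R): a\widetilde R\subseteq R\}$. $R$ is called $1$-step normal if $\widetilde R\cong \operatorname{End}_R(\mathfrak{m})$ (isomorphism of $R$-algebras). *)

theory Defs
  imports "HOL-Algebra.Polynomials" "HOL-Algebra.Module" "HOL-Library.Extended_Nat"
begin

section \<open>Local rings, reducedness, Krull dimension\<close>

locale local_ring = cring R + maximalideal \<mm> R for R (structure) and \<mm> +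
  assumes maximal_unique: "maximalideal J R \<Longrightarrow> J = \<mm>"

definition reduced_ring :: "('a, 'b) ring_scheme \<Rightarrow> bool" where
  "reduced_ring R \<longleftrightarrow>
     (\<forall>x \<in> carrier R. \<forall>n::nat. x [^]\<^bsub>R\<^esub> n = \<zero>\<^bsub>R\<^esub> \<longrightarrow> x = \<zero>\<^bsub>R\<^esub>)"

definition prime_chain :: "('a, 'b) ring_scheme \<Rightarrow> nat \<Rightarrow> (nat \<Rightarrow> 'a set) \<Rightarrow> bool" where
  "prime_chain R n P \<longleftrightarrow> (\<forall>i\<le>n. primeideal (P i) R) \<and> (\<forall>i<n. P i \<subset> P (Suc i))"

text \<open>For the zero ring this supremum is \<open>0\<close>; all rings of interest here are local, hence nonzero.\<close>

definition krull_dim :: "('a, 'b) ring_scheme \<Rightarrow> enat" where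
  "krull_dim R = Sup {enat n | n. \<exists>P. prime_chain R n P}"

section \<open>Modules and algebras\<close>

definition fin_gen_module :: "('a, 'b) ring_scheme \<Rightarrow> ('a, 'c, 'd) module_scheme \<Rightarrow> bool" where
  "fin_gen_module R M \<longleftrightarrow>
     (\<exists>S. finite S \<and> S \<subseteq> carrier M \<and>
       (\<forall>x \<in> carrier M. \<exists>c \<in> S \<rightarrow> carrier R. x = (\<Oplus>\<^bsub>M\<^esub>s\<in>S. c s \<odot>\<^bsub>M\<^esub> s)))"

text \<open>The fields \<open>mult\<close> and \<open>one\<close> are required by the record type but play no role
  in the module structure.\<close>

definition ideal_module :: "('a, 'b) ring_scheme \<Rightarrow> 'a set \<Rightarrow> ('a, 'a) module" where
  "ideal_module R I =
     \<lparr>carrier = I, mult = mult R, one = \<one>\<^bsub>R\<^esub>, zero = \<zero>\<^bsub>R\<^esub>, add = add R, smult = mult R\<rparr>"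

text \<open>Endomorphisms are taken extensional (undefined off the carrier), so that equality of
  elements of the ring is equality of maps on \<open>M\<close>.\<close>

definition module_End ::
    "('a, 'b) ring_scheme \<Rightarrow> ('a, 'c, 'd) module_scheme \<Rightarrow> ('a, 'c \<Rightarrow> 'c) module" where
  "module_End R M =
     \<lparr>carrier = {f \<in> carrier M \<rightarrow>\<^sub>E carrier M.
        (\<forall>x \<in> carrier M. \<forall>y \<in> carrier M. f (x \<oplus>\<^bsub>M\<^esub> y) = f x \<oplus>\<^bsub>M\<^esub> f y) \<and>
        (\<forall>r \<in> carrier R. \<forall>x \<in> carrier M. f (r \<odot>\<^bsub>M\<^esub> x) = r \<odot>\<^bsub>M\<^esub> f x)},
      mult = (\<lambda>f g. compose (carrier M) f g),
      one = (\<lambda>x \<in> carrier M. x),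
      zero = (\<lambda>x \<in> carrier M. \<zero>\<^bsub>M\<^esub>),
      add = (\<lambda>f g. \<lambda>x \<in> carrier M. f x \<oplus>\<^bsub>M\<^esub> g x),
      smult = (\<lambda>r f. \<lambda>x \<in> carrier M. r \<odot>\<^bsub>M\<^esub> f x)\<rparr>"

definition algebra_iso ::
    "('a, 'b) ring_scheme \<Rightarrow> ('a, 'c, 'd) module_scheme \<Rightarrow> ('a, 'e, 'f) module_scheme \<Rightarrow> ('c \<Rightarrow> 'e) set" where
  "algebra_iso R A B =
     {h \<in> ring_iso A B. \<forall>r \<in> carrier R. \<forall>x \<in> carrier A. h (r \<odot>\<^bsub>A\<^esub> x) = r \<odot>\<^bsub>B\<^esub> h x}"

section \<open>Total ring of fractions\<close>

definition regular_elements :: "('a, 'b) ring_scheme \<Rightarrow> 'a set" where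
  "regular_elements R =
     {s \<in> carrier R. \<forall>a \<in> carrier R. s \<otimes>\<^bsub>R\<^esub> a = \<zero>\<^bsub>R\<^esub> \<longrightarrow> a = \<zero>\<^bsub>R\<^esub>}"

text \<open>The fraction \<open>a/s\<close> is the class of all pairs \<open>(b, t)\<close> with \<open>a t = b s\<close>. Since the
  denominators are regular, this is already an equivalence relation. The operations below take the
  union over all representatives; all members of that union agree, so it is again a class.\<close>

definition fraction :: "('a, 'b) ring_scheme \<Rightarrow> 'a \<Rightarrow> 'a \<Rightarrow> ('a \<times> 'a) set" where
  "fraction R a s =
     {(b, t). b \<in> carrier R \<and> t \<in> regular_elements R \<and> a \<otimes>\<^bsub>R\<^esub> t = b \<otimes>\<^bsub>R\<^esub> s}"

definition total_fractions :: "('a, 'b) ring_scheme \<Rightarrow> ('a, ('a \<times> 'a) set) module" where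
  "total_fractions R =
     \<lparr>carrier = {fraction R a s | a s. a \<in> carrier R \<and> s \<in> regular_elements R},
      mult = (\<lambda>A B. \<Union>(a, s)\<in>A. \<Union>(b, t)\<in>B. fraction R (a \<otimes>\<^bsub>R\<^esub> b) (s \<otimes>\<^bsub>R\<^esub> t)),
      one = fraction R \<one>\<^bsub>R\<^esub> \<one>\<^bsub>R\<^esub>,
      zero = fraction R \<zero>\<^bsub>R\<^esub> \<one>\<^bsub>R\<^esub>,
      add = (\<lambda>A B. \<Union>(a, s)\<in>A. \<Union>(b, t)\<in>B.
               fraction R (a \<otimes>\<^bsub>R\<^esub> t \<oplus>\<^bsub>R\<^esub> b \<otimes>\<^bsub>R\<^esub> s) (s \<otimes>\<^bsub>R\<^esub> t)),
      smult = (\<lambda>r A. \<Union>(a, s)\<in>A. fraction R (r \<otimes>\<^bsub>R\<^esub> a) s)\<rparr>"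

definition frac_embed :: "('a, 'b) ring_scheme \<Rightarrow> 'a \<Rightarrow> ('a \<times> 'a) set" where
  "frac_embed R a = fraction R a \<one>\<^bsub>R\<^esub>"

section \<open>Normalization, conductor, 1-step normality\<close>

definition integral_over :: "('a, 'b) ring_scheme \<Rightarrow> 'a set \<Rightarrow> 'a \<Rightarrow> bool" where
  "integral_over S K x \<longleftrightarrow>
     (\<exists>p \<in> carrier (K[X]\<^bsub>S\<^esub>). p \<noteq> [] \<and> lead_coeff p = \<one>\<^bsub>S\<^esub> \<and> ring.eval S p x = \<zero>\<^bsub>S\<^esub>)"

definition normalization :: "('a, 'b) ring_scheme \<Rightarrow> ('a, ('a \<times> 'a) set) module" where
  "normalization R = (total_fractions R)
     \<lparr>carrier := {x \<in> carrier (total_fractions R).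
        integral_over (total_fractions R) (frac_embed R ` carrier R) x}\<rparr>"

definition conductor :: "('a, 'b) ring_scheme \<Rightarrow> ('a \<times> 'a) set set" where
  "conductor R = {a \<in> carrier (total_fractions R).
     \<forall>x \<in> carrier (normalization R). a \<otimes>\<^bsub>total_fractions R\<^esub> x \<in> frac_embed R ` carrier R}"

definition one_step_normal :: "('a, 'b) ring_scheme \<Rightarrow> 'a set \<Rightarrow> bool" where
  "one_step_normal R \<mm> \<longleftrightarrow>
     algebra_iso R (normalization R) (module_End R (ideal_module R \<mm>)) \<noteq> {}"

section \<open>The total ring of fractions is an algebra extending the ring\<close>

context cring
begin

lemma regular_closed: "s \<in> regular_elements R \<Longrightarrow> s \<in> carrier R"
  by (simp add: regular_elements_def)

lemma regularD: "\<lbrakk>s \<in> regular_elements R; a \<in> carrier R; s \<otimes> a = \<zero>\<rbrakk> \<Longrightarrow> a = \<zero>"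
  unfolding regular_elements_def by blast

lemma regular_one: "\<one> \<in> regular_elements R"
  by (simp add: regular_elements_def)

lemma regular_mult:
  assumes "s \<in> regular_elements R" "t \<in> regular_elements R"
  shows "s \<otimes> t \<in> regular_elements R"
proof -
  have "a = \<zero>" if "a \<in> carrier R" "s \<otimes> t \<otimes> a = \<zero>" for a
  proof -
    have "s \<otimes> (t \<otimes> a) = \<zero>" using that assms[THEN regular_closed] by (simp add: m_assoc)
    then have "t \<otimes> a = \<zero>"
      using that(1) assms[THEN regular_closed] regularD[OF assms(1)] by blast
    then show ?thesis using that(1) regularD[OF assms(2)] by blast
  qed
  then show ?thesis
    using assms[THEN regular_closed] unfolding regular_elements_def by blast
qed

lemma regular_cancel:
  assumes "s \<in> regular_elements R" "a \<in> carrier R" "b \<in> carrier R" "s \<otimes> a = s \<otimes> b"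
  shows "a = b"
proof -
  have sR: "s \<in> carrier R" using assms(1) by (rule regular_closed)
  have "s \<otimes> (a \<ominus> b) = s \<otimes> a \<ominus> s \<otimes> b"
    using sR assms by (simp add: minus_eq r_distr r_minus)
  also have "\<dots> = \<zero>" using assms sR by (simp add: minus_eq r_neg)
  finally have "a \<ominus> b = \<zero>"
    using assms(2,3) regularD[OF assms(1)] by simp
  then show ?thesis using assms(2,3) by simp
qed

lemma mem_fraction_iff:
  "(b, t) \<in> fraction R a s \<longleftrightarrow> b \<in> carrier R \<and> t \<in> regular_elements R \<and> a \<otimes> t = b \<otimes> s"
  by (simp add: fraction_def)

lemma fraction_self:
  "\<lbrakk>a \<in> carrier R; s \<in> regular_elements R\<rbrakk> \<Longrightarrow> (a, s) \<in> fraction R a s"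
  by (simp add: fraction_def)

lemma fraction_trans:
  assumes R: "a \<in> carrier R" "b \<in> carrier R" "c \<in> carrier R"
    and S: "s \<in> regular_elements R" "t \<in> regular_elements R" "u \<in> regular_elements R"
    and e: "a \<otimes> t = b \<otimes> s" "b \<otimes> u = c \<otimes> t"
  shows "a \<otimes> u = c \<otimes> s"
proof -
  note S' = S[THEN regular_closed]
  have "t \<otimes> (a \<otimes> u) = (a \<otimes> t) \<otimes> u" using R S' by (simp add: m_ac)
  also have "\<dots> = (b \<otimes> u) \<otimes> s" using R S' e(1) by (simp add: m_ac)
  also have "\<dots> = t \<otimes> (c \<otimes> s)" using R S' e(2) by (simp add: m_ac)
  finally show ?thesis using regular_cancel[OF S(2)] R S' by simp
qed

lemma fraction_eq_iff:
  assumes "a \<in> carrier R" "s \<in> regular_elements R" "b \<in> carrier R" "t \<in> regular_elements R"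
  shows "fraction R a s = fraction R b t \<longleftrightarrow> a \<otimes> t = b \<otimes> s"
proof
  assume "fraction R a s = fraction R b t"
  then have "(b, t) \<in> fraction R a s" using fraction_self assms by simp
  then show "a \<otimes> t = b \<otimes> s" by (simp add: mem_fraction_iff)
next
  assume e: "a \<otimes> t = b \<otimes> s"
  show "fraction R a s = fraction R b t"
  proof (rule Set.set_eqI)
    fix p :: "'a \<times> 'a"
    obtain c u where p: "p = (c, u)" by (cases p)
    show "p \<in> fraction R a s \<longleftrightarrow> p \<in> fraction R b t"
      unfolding p mem_fraction_iff
      using fraction_trans[OF assms(3,1) _ assms(4,2) _ e[symmetric], of c u]
        fraction_trans[OF assms(1,3) _ assms(2,4) _ e, of c u] by blast
  qed
qed

lemma mult_fraction:
  assumes "a \<in> carrier R" "s \<in> regular_elements R" "b \<in> carrier R" "t \<in> regular_elements R"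
  shows "fraction R a s \<otimes>\<^bsub>total_fractions R\<^esub> fraction R b t = fraction R (a \<otimes> b) (s \<otimes> t)"
proof -
  have *: "fraction R (c \<otimes> d) (u \<otimes> v) = fraction R (a \<otimes> b) (s \<otimes> t)"
    if "(c, u) \<in> fraction R a s" "(d, v) \<in> fraction R b t" for c u d v
  proof -
    have h: "c \<in> carrier R" "u \<in> regular_elements R" "a \<otimes> u = c \<otimes> s"
      "d \<in> carrier R" "v \<in> regular_elements R" "b \<otimes> v = d \<otimes> t"
      using that by (auto simp: mem_fraction_iff)
    note S = assms(2,4)[THEN regular_closed] h(2,5)[THEN regular_closed]
    have "(c \<otimes> d) \<otimes> (s \<otimes> t) = (c \<otimes> s) \<otimes> (d \<otimes> t)" using assms h(1,2,4,5) S by (simp add: m_ac)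
    also have "\<dots> = (a \<otimes> u) \<otimes> (b \<otimes> v)" using h(3,6) by simp
    also have "\<dots> = (a \<otimes> b) \<otimes> (u \<otimes> v)" using assms h(1,2,4,5) S by (simp add: m_ac)
    finally show ?thesis using assms h(1,2,4,5) S by (simp add: fraction_eq_iff regular_mult)
  qed
  have "(\<Union>(c, u)\<in>fraction R a s. \<Union>(d, v)\<in>fraction R b t. fraction R (c \<otimes> d) (u \<otimes> v))
      = (\<Union>_\<in>fraction R a s. \<Union>_\<in>fraction R b t. fraction R (a \<otimes> b) (s \<otimes> t))"
    using * by (auto intro!: SUP_cong simp del: UN_constant)
  also have "\<dots> = fraction R (a \<otimes> b) (s \<otimes> t)"
    using fraction_self[OF assms(1,2)] fraction_self[OF assms(3,4)] by blast
  finally show ?thesis by (simp add: total_fractions_def)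
qed

lemma add_fraction:
  assumes "a \<in> carrier R" "s \<in> regular_elements R" "b \<in> carrier R" "t \<in> regular_elements R"
  shows "fraction R a s \<oplus>\<^bsub>total_fractions R\<^esub> fraction R b t
           = fraction R (a \<otimes> t \<oplus> b \<otimes> s) (s \<otimes> t)"
proof -
  have *: "fraction R (c \<otimes> v \<oplus> d \<otimes> u) (u \<otimes> v) = fraction R (a \<otimes> t \<oplus> b \<otimes> s) (s \<otimes> t)"
    if "(c, u) \<in> fraction R a s" "(d, v) \<in> fraction R b t" for c u d v
  proof -
    have h: "c \<in> carrier R" "u \<in> regular_elements R" "a \<otimes> u = c \<otimes> s"
      "d \<in> carrier R" "v \<in> regular_elements R" "b \<otimes> v = d \<otimes> t"
      using that by (auto simp: mem_fraction_iff)
    note S = assms(2,4)[THEN regular_closed] h(2,5)[THEN regular_closed]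
    have "(c \<otimes> v \<oplus> d \<otimes> u) \<otimes> (s \<otimes> t) = (c \<otimes> s) \<otimes> (v \<otimes> t) \<oplus> (d \<otimes> t) \<otimes> (u \<otimes> s)"
      using assms h(1,2,4,5) S by (simp add: m_ac l_distr r_distr)
    also have "\<dots> = (a \<otimes> u) \<otimes> (v \<otimes> t) \<oplus> (b \<otimes> v) \<otimes> (u \<otimes> s)" using h(3,6) by simp
    also have "\<dots> = (a \<otimes> t \<oplus> b \<otimes> s) \<otimes> (u \<otimes> v)" using assms h(1,2,4,5) S by (simp add: m_ac l_distr r_distr)
    finally show ?thesis using assms h(1,2,4,5) S by (simp add: fraction_eq_iff regular_mult)
  qed
  have "(\<Union>(c, u)\<in>fraction R a s. \<Union>(d, v)\<in>fraction R b t. fraction R (c \<otimes> v \<oplus> d \<otimes> u) (u \<otimes> v))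
      = (\<Union>_\<in>fraction R a s. \<Union>_\<in>fraction R b t. fraction R (a \<otimes> t \<oplus> b \<otimes> s) (s \<otimes> t))"
    using * by (auto intro!: SUP_cong simp del: UN_constant)
  also have "\<dots> = fraction R (a \<otimes> t \<oplus> b \<otimes> s) (s \<otimes> t)"
    using fraction_self[OF assms(1,2)] fraction_self[OF assms(3,4)] by blast
  finally show ?thesis by (simp add: total_fractions_def)
qed

lemma smult_fraction:
  assumes "r \<in> carrier R" "a \<in> carrier R" "s \<in> regular_elements R"
  shows "r \<odot>\<^bsub>total_fractions R\<^esub> fraction R a s = fraction R (r \<otimes> a) s"
proof -
  have *: "fraction R (r \<otimes> c) u = fraction R (r \<otimes> a) s"
    if "(c, u) \<in> fraction R a s" for c u
  proof -
    have h: "c \<in> carrier R" "u \<in> regular_elements R" "a \<otimes> u = c \<otimes> s"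
      using that by (auto simp: mem_fraction_iff)
    then show ?thesis
      using assms assms(3)[THEN regular_closed] h(2)[THEN regular_closed]
      by (simp add: fraction_eq_iff m_assoc)
  qed
  have "(\<Union>(c, u)\<in>fraction R a s. fraction R (r \<otimes> c) u)
      = (\<Union>_\<in>fraction R a s. fraction R (r \<otimes> a) s)"
    using * by (auto intro!: SUP_cong simp del: UN_constant)
  also have "\<dots> = fraction R (r \<otimes> a) s"
    using fraction_self[OF assms(2,3)] by blast
  finally show ?thesis by (simp add: total_fractions_def)
qed

lemma carrier_total_fractions:
  "carrier (total_fractions R) = {fraction R a s | a s. a \<in> carrier R \<and> s \<in> regular_elements R}"
  by (simp add: total_fractions_def)

lemma fraction_closed:
  "\<lbrakk>a \<in> carrier R; s \<in> regular_elements R\<rbrakk> \<Longrightarrow> fraction R a s \<in> carrier (total_fractions R)"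
  by (auto simp: carrier_total_fractions)

lemma total_fractions_cases:
  assumes "x \<in> carrier (total_fractions R)"
  obtains a s where "a \<in> carrier R" "s \<in> regular_elements R" "x = fraction R a s"
  using assms by (auto simp: carrier_total_fractions)

lemma zero_total_fractions: "\<zero>\<^bsub>total_fractions R\<^esub> = fraction R \<zero> \<one>"
  by (simp add: total_fractions_def)

lemma one_total_fractions: "\<one>\<^bsub>total_fractions R\<^esub> = fraction R \<one> \<one>"
  by (simp add: total_fractions_def)

lemmas fraction_simps = zero_total_fractions one_total_fractions mult_fraction add_fraction
  smult_fraction regular_mult regular_one regular_closed fraction_eq_iff fraction_closed

lemma total_fractions_abelian_group: "abelian_group (total_fractions R)"
proof (rule abelian_groupI)
  fix x assume "x \<in> carrier (total_fractions R)"
  then obtain a s where x: "x = fraction R a s" "a \<in> carrier R" "s \<in> regular_elements R"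
    by (metis total_fractions_cases)
  have "fraction R (\<ominus> a) s \<in> carrier (total_fractions R)"
    using x by (simp add: fraction_closed)
  moreover have "fraction R (\<ominus> a) s \<oplus>\<^bsub>total_fractions R\<^esub> x = \<zero>\<^bsub>total_fractions R\<^esub>"
    using x by (simp add: fraction_simps l_minus l_neg)
  ultimately show "\<exists>y\<in>carrier (total_fractions R). y \<oplus>\<^bsub>total_fractions R\<^esub> x = \<zero>\<^bsub>total_fractions R\<^esub>"
    by blast
qed ((elim total_fractions_cases)?, simp add: fraction_simps m_ac a_ac l_distr r_distr)+

lemma total_fractions_cring: "cring (total_fractions R)"
proof (rule cringI)
  show "abelian_group (total_fractions R)" by (rule total_fractions_abelian_group)
  show "comm_monoid (total_fractions R)"
    by (rule comm_monoidI)
      ((elim total_fractions_cases)?, simp add: fraction_simps m_ac)+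
qed ((elim total_fractions_cases)?, simp add: fraction_simps m_ac a_ac l_distr r_distr)

lemma total_fractions_algebra: "algebra R (total_fractions R)"
  by (rule algebraI[OF is_cring total_fractions_cring])
    ((elim total_fractions_cases)?, simp add: fraction_simps m_ac a_ac l_distr r_distr)+

lemma frac_embed_hom: "frac_embed R \<in> ring_hom R (total_fractions R)"
  by (rule ring_hom_memI) (simp_all add: frac_embed_def fraction_simps)

lemma frac_embed_inj: "inj_on (frac_embed R) (carrier R)"
  by (auto simp: inj_on_def frac_embed_def fraction_simps)

lemma frac_embed_regular_unit:
  assumes "s \<in> regular_elements R"
  shows "frac_embed R s \<otimes>\<^bsub>total_fractions R\<^esub> fraction R \<one> s = \<one>\<^bsub>total_fractions R\<^esub>"
  using assms by (simp add: frac_embed_def fraction_simps)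

lemma fraction_conv_embed:
  assumes "a \<in> carrier R" "s \<in> regular_elements R"
  shows "fraction R a s = frac_embed R a \<otimes>\<^bsub>total_fractions R\<^esub> fraction R \<one> s"
  using assms by (simp add: frac_embed_def fraction_simps)

end

end

theory Submission
  imports Defs
begin

text \<open>Since \<open>R\<close> is reduced of positive dimension, \<open>\<mm>\<close> contains a regular element \<open>s\<close>, so every
  endomorphism \<open>f\<close> of \<open>\<mm>\<close> is multiplication by the fraction \<open>f(s)/s\<close>, which is integral over \<open>R\<close>
  because it stabilises \<open>\<mm>\<close>. Conversely, if \<open>\<mm>\<close> multiplies the normalization into \<open>R\<close>, the
  products already lie in \<open>\<mm>\<close>: a unit among them would make the inverse of an element of \<open>\<mm>\<close>
  integral over \<open>R\<close>. Hence the endomorphism ring is the normalization acting by multiplication. An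
  abstract algebra isomorphism has to be this one, by linearity over denominators.\<close>

section \<open>Ideals of a noetherian ring\<close>

text \<open>In a noetherian ring the union of a nonempty chain of ideals is itself a member of the
  chain, so every chain in \<open>F\<close> is bounded within \<open>F\<close> and Zorn's lemma
  applies.\<close>

lemma (in noetherian_ring) ideal_family_has_maximal:
  assumes "F \<noteq> {}" and "\<And>I. I \<in> F \<Longrightarrow> ideal I R"
  obtains M where "M \<in> F" and "\<And>I. I \<in> F \<Longrightarrow> M \<subseteq> I \<Longrightarrow> I = M"
proof -
  have "\<Union>C \<in> F" if "C \<noteq> {}" "subset.chain F C" for C
  proof -
    have "subset.chain {I. ideal I R} C"
      using that(2) assms(2) by (auto simp: pred_on.chain_def)
    then have "\<Union>C \<in> C" using that(1) ideal_chain_is_trivial by blast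
    then show ?thesis using that(2) by (auto simp: pred_on.chain_def)
  qed
  then show thesis using subset_Zorn_nonempty[OF assms(1)] that by metis
qed

lemma (in cring) idealI_left_multiples:
  assumes "I \<subseteq> carrier R" "\<zero> \<in> I"
    and "\<And>x y. x \<in> I \<Longrightarrow> y \<in> I \<Longrightarrow> x \<oplus> y \<in> I"
    and "\<And>r x. r \<in> carrier R \<Longrightarrow> x \<in> I \<Longrightarrow> r \<otimes> x \<in> I"
  shows "ideal I R"
proof (rule idealI)
  show "subgroup I (add_monoid R)"
  proof (rule add.subgroupI)
    show "\<ominus> x \<in> I" if "x \<in> I" for x
    proof -
      have "\<ominus> x = (\<ominus> \<one>) \<otimes> x" using that assms(1) by (auto simp: l_minus)
      then show ?thesis using assms(4)[of "\<ominus> \<one>" x] that by simp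
    qed
  qed (use assms in auto)
  show "x \<otimes> r \<in> I" if "x \<in> I" "r \<in> carrier R" for x r
    using assms(4)[OF that(2,1)] assms(1) that by (simp add: m_comm subsetD)
qed (use assms ring_axioms in auto)

section \<open>Annihilators and regular elements in a reduced ring\<close>

lemma (in cring) reduced_square_zero:
  assumes "reduced_ring R" "x \<in> carrier R" "x \<otimes> x = \<zero>"
  shows "x = \<zero>"
proof -
  have "x [^] (2::nat) = \<zero>" using assms(2,3) by (simp add: numeral_2_eq_2)
  then show ?thesis using assms(1,2) unfolding reduced_ring_def by blast
qed

text \<open>This is the double annihilator of \<open>a\<close>. Passing to it reverses inclusions
  between annihilators, so a minimal annihilator becomes a maximal ideal of a family, which
  noetherianity provides.\<close>

definition ann_closure :: "('a, 'b) ring_scheme \<Rightarrow> 'a \<Rightarrow> 'a set" where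
  "ann_closure R a = {x \<in> carrier R. \<forall>y \<in> carrier R. y \<otimes>\<^bsub>R\<^esub> a = \<zero>\<^bsub>R\<^esub> \<longrightarrow> y \<otimes>\<^bsub>R\<^esub> x = \<zero>\<^bsub>R\<^esub>}"

lemma (in cring) ann_closure_ideal:
  assumes "a \<in> carrier R"
  shows "ideal (ann_closure R a) R"
proof (rule idealI_left_multiples)
  show "r \<otimes> x \<in> ann_closure R a" if "r \<in> carrier R" "x \<in> ann_closure R a" for r x
  proof -
    have "y \<otimes> (r \<otimes> x) = r \<otimes> (y \<otimes> x)" if "y \<in> carrier R" for y
      using that \<open>r \<in> carrier R\<close> \<open>x \<in> ann_closure R a\<close> by (intro m_lcomm) (auto simp: ann_closure_def)
    then show ?thesis using that by (auto simp: ann_closure_def)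
  qed
qed (use assms in \<open>auto simp: ann_closure_def r_distr\<close>)

text \<open>Choose \<open>a\<close> in the ideal with the smallest annihilator. If \<open>z a = 0\<close> with \<open>z c \<noteq> 0\<close> for some
  \<open>c\<close> in the ideal, then \<open>a + z c\<close> has a strictly smaller annihilator.\<close>

lemma (in cring) ideal_regular_or_annihilated:
  assumes "noetherian_ring R" and red: "reduced_ring R" and "ideal I R"
  shows "I \<inter> regular_elements R \<noteq> {} \<or> (\<exists>z \<in> carrier R - {\<zero>}. \<forall>x \<in> I. z \<otimes> x = \<zero>)"
proof (rule disjCI)
  assume no_ann: "\<not> (\<exists>z \<in> carrier R - {\<zero>}. \<forall>x \<in> I. z \<otimes> x = \<zero>)"
  interpret I: ideal I R by fact
  interpret noetherian_ring R by fact
  have "ann_closure R ` I \<noteq> {}" using I.zero_closed by blast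
  then obtain M where M: "M \<in> ann_closure R ` I"
    and max: "\<And>J. J \<in> ann_closure R ` I \<Longrightarrow> M \<subseteq> J \<Longrightarrow> J = M"
    by (rule ideal_family_has_maximal[of "ann_closure R ` I"]) (use ann_closure_ideal in auto)
  then obtain a where a: "a \<in> I" "M = ann_closure R a" by blast
  have aR: "a \<in> carrier R" using a(1) by simp
  have "z = \<zero>" if z: "z \<in> carrier R" "a \<otimes> z = \<zero>" for z
  proof (rule ccontr)
    assume "z \<noteq> \<zero>"
    then obtain c where c: "c \<in> I" "z \<otimes> c \<noteq> \<zero>" using no_ann z(1) by blast
    define d where "d = z \<otimes> c"
    have d: "d \<in> I" "d \<in> carrier R" "d \<noteq> \<zero>" using c z(1) by (auto simp: d_def I.I_l_closed)
    have da: "d \<otimes> a = \<zero>"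
    proof -
      have "d \<otimes> a = c \<otimes> (a \<otimes> z)" using z(1) aR c(1) unfolding d_def by (simp add: m_ac)
      then show ?thesis using z(2) c(1) by simp
    qed
    define b where "b = a \<oplus> d"
    have b: "b \<in> I" "b \<in> carrier R" using a(1) d by (auto simp: b_def)
    \<comment> \<open>Since \<open>d \<otimes> a = \<zero>\<close>, the square of
      \<open>x \<otimes> a\<close> equals \<open>x \<otimes> a\<close> times
      \<open>x \<otimes> a \<oplus> x \<otimes> d\<close>, which is zero. Reducedness kills
      \<open>x \<otimes> a\<close>, and then \<open>x \<otimes> d\<close> vanishes too.\<close>
    have ann_b: "x \<otimes> a = \<zero> \<and> x \<otimes> d = \<zero>" if x: "x \<in> carrier R" "x \<otimes> b = \<zero>" for x
    proof -
      have sum0: "x \<otimes> a \<oplus> x \<otimes> d = \<zero>" using x aR d by (simp add: b_def r_distr)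
      have "(x \<otimes> a) \<otimes> (x \<otimes> a) = (x \<otimes> a) \<otimes> (x \<otimes> a) \<oplus> x \<otimes> x \<otimes> (d \<otimes> a)"
        using da x aR by simp
      also have "\<dots> = (x \<otimes> a) \<otimes> (x \<otimes> a \<oplus> x \<otimes> d)"
        using x aR d by (simp add: r_distr m_ac)
      finally have "(x \<otimes> a) \<otimes> (x \<otimes> a) = \<zero>" using sum0 x aR by simp
      then have xa: "x \<otimes> a = \<zero>" using reduced_square_zero[OF red, of "x \<otimes> a"] x aR by blast
      then show ?thesis using sum0 x d by simp
    qed
    have "ann_closure R a \<subseteq> ann_closure R b"
      using ann_b by (auto simp: ann_closure_def)
    then have "ann_closure R b = ann_closure R a" using max b(1) a(2) by blast
    \<comment> \<open>So \<open>b\<close> lies in the double annihilator of \<open>a\<close>. As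
      \<open>d\<close> kills \<open>a\<close>, it kills \<open>b\<close>, and \<open>ann_b\<close>
      with \<open>x = d\<close> gives \<open>d \<otimes> d = \<zero>\<close>.\<close>
    moreover have "b \<in> ann_closure R b" using b(2) by (simp add: ann_closure_def)
    ultimately have "d \<otimes> b = \<zero>" using da d(2) by (auto simp: ann_closure_def)
    then show False using ann_b[OF d(2)] reduced_square_zero[OF red d(2)] d(3) by blast
  qed
  then have "a \<in> regular_elements R" using aR by (auto simp: regular_elements_def)
  then show "I \<inter> regular_elements R \<noteq> {}" using a(1) by blast
qed

section \<open>The maximal ideal of a noetherian local ring\<close>

text \<open>A maximal member of the family of proper ideals containing \<open>I\<close> is a maximal
  ideal of the ring, and locality leaves only \<open>\<mm>\<close>.\<close>

lemma (in local_ring) proper_ideal_subset_maximal: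
  assumes "noetherian_ring R" "ideal I R" "I \<noteq> carrier R"
  shows "I \<subseteq> \<mm>"
proof -
  interpret noetherian_ring R by fact
  let ?F = "{J. ideal J R \<and> I \<subseteq> J \<and> J \<noteq> carrier R}"
  obtain M where M: "M \<in> ?F" and max: "\<And>J. J \<in> ?F \<Longrightarrow> M \<subseteq> J \<Longrightarrow> J = M"
    by (rule ideal_family_has_maximal[of ?F]) (use assms(2,3) in auto)
  have "maximalideal M R"
  proof (rule maximalidealI)
    show "J = M \<or> J = carrier R" if "ideal J R" "M \<subseteq> J" "J \<subseteq> carrier R" for J
      using max[of J] that M by blast
  qed (use M in auto)
  then show ?thesis using maximal_unique M by blast
qed

text \<open>Otherwise some nonzero \<open>z\<close> kills \<open>\<mm>\<close>. It is not in
  \<open>\<mm>\<close>, because its square would vanish, so it is a unit and \<open>\<mm>\<close> is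
  zero. Then no two primes are strictly nested and the dimension is zero.\<close>

lemma (in local_ring) maximal_ideal_has_regular:
  assumes noeth: "noetherian_ring R" and red: "reduced_ring R" and "krull_dim R = 1"
  shows "\<mm> \<inter> regular_elements R \<noteq> {}"
proof (rule ccontr)
  assume "\<not> ?thesis"
  then obtain z where z: "z \<in> carrier R" "z \<noteq> \<zero>" "\<And>x. x \<in> \<mm> \<Longrightarrow> z \<otimes> x = \<zero>"
    using ideal_regular_or_annihilated[OF noeth red is_ideal] by blast
  have "z \<notin> \<mm>" using z reduced_square_zero[OF red] by blast
  then have "PIdl z = carrier R"
    using proper_ideal_subset_maximal[OF noeth cgenideal_ideal[OF z(1)]] cgenideal_self[OF z(1)]
    by blast
  then obtain w where w: "w \<in> carrier R" "\<one> = w \<otimes> z"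
    using one_closed unfolding cgenideal_def by blast
  have m0: "x = \<zero>" if "x \<in> \<mm>" for x
  proof -
    have "x = w \<otimes> (z \<otimes> x)" using w z(1) that by (metis Icarr l_one m_assoc)
    then show ?thesis using z(3)[OF that] w(1) by simp
  qed
  have "n = 0" if P: "prime_chain R n P" for n P
  proof (rule ccontr)
    assume "n \<noteq> 0"
    then have p: "primeideal (P 0) R" "primeideal (P 1) R" "P 0 \<subset> P 1"
      using P by (auto simp: prime_chain_def)
    then have "P 1 \<subseteq> \<mm>"
      using proper_ideal_subset_maximal[OF noeth] primeideal.I_notcarr primeideal.axioms(1) by metis
    moreover have "\<zero> \<in> P 0"
      using p(1) by (meson additive_subgroup.zero_closed ideal.axioms(1) primeideal.axioms(1))
    ultimately show False using p(3) m0 by blast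
  qed
  then have "krull_dim R \<le> 0"
    unfolding krull_dim_def by (intro Sup_least) (auto simp: zero_enat_def)
  then show False using assms(3) by simp
qed

section \<open>Integral equations as coefficient lists\<close>

lemma (in cring) eval_uminus:
  assumes "set cs \<subseteq> carrier R" "x \<in> carrier R"
  shows "eval (map (\<lambda>c. \<ominus> c) cs) x = \<ominus> eval cs x"
  using assms by (induction cs) (auto simp: eval_in_carrier l_minus minus_add)

text \<open>Moving all terms but the leading one to the other side turns a monic equation into one
  with an arbitrary coefficient list \<open>cs\<close>. Leading zeros are allowed in
  \<open>cs\<close>, so lists of a fixed length can be added and scaled freely.\<close>

lemma integral_over_iff:
  fixes S (structure)
  assumes "cring S" "subring K S" "\<one> \<noteq> \<zero>" "x \<in> carrier S"
  shows "integral_over S K x \<longleftrightarrow> (\<exists>cs. set cs \<subseteq> K \<and> x [^] length cs = ring.eval S cs x)"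
proof -
  interpret cring S by fact
  interpret K: subring K S by fact
  have KS: "K \<subseteq> carrier S" by (rule K.subset)
  show ?thesis
  proof
    assume "integral_over S K x"
    then obtain p where p: "polynomial K p" "p \<noteq> []" "hd p = \<one>" "eval p x = \<zero>"
      unfolding integral_over_def by (auto simp: univ_poly_carrier)
    then obtain cs where cs: "p = \<one> # cs" by (cases p) auto
    have csK: "set cs \<subseteq> K" using p(1) cs by (auto simp: polynomial_def)
    then have csS: "set cs \<subseteq> carrier S" using KS by blast
    have "x [^] length cs \<oplus> eval cs x = \<zero>"
      using p(4) cs assms(4) by simp
    then have "x [^] length cs = \<ominus> eval cs x"
      using eval_in_carrier[OF csS] assms(4) by (intro minus_equality[symmetric]) auto
    also have "\<dots> = eval (map (\<lambda>c. \<ominus> c) cs) x" using eval_uminus[OF csS] assms(4) by simp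
    finally show "\<exists>cs. set cs \<subseteq> K \<and> x [^] length cs = eval cs x"
      using csK by (intro exI[of _ "map (\<lambda>c. \<ominus> c) cs"]) (auto simp: subringE(5)[OF assms(2)])
  next
    assume "\<exists>cs. set cs \<subseteq> K \<and> x [^] length cs = eval cs x"
    then obtain cs where cs: "set cs \<subseteq> K" "x [^] length cs = eval cs x" by blast
    let ?p = "\<one> # map (\<lambda>c. \<ominus> c) cs"
    have csS: "set cs \<subseteq> carrier S" using cs(1) KS by blast
    \<comment> \<open>A nonempty polynomial must have a nonzero leading coefficient; here this is
      \<open>\<one> \<noteq> \<zero>\<close>.\<close>
    have "polynomial K ?p"
      using cs(1) assms(3) by (auto simp: polynomial_def subringE(5)[OF assms(2)])
    moreover have "eval ?p x = \<zero>"
      using eval_uminus[OF csS] cs(2) eval_in_carrier[OF csS] assms(4) by (simp add: r_neg)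
    ultimately show "integral_over S K x"
      unfolding integral_over_def by (intro bexI[of _ ?p]) (auto simp: univ_poly_carrier)
  qed
qed

text \<open>With equal lengths, entries at the same position belong to the same power, so the lists
  can be added entrywise. Keeping the length gives closure under addition of the polynomials below a
  given degree.\<close>

lemma (in cring) eval_sum_ex:
  assumes "subring K R" "set as \<subseteq> K" "set bs \<subseteq> K" "length as = length bs" "x \<in> carrier R"
  obtains cs where "set cs \<subseteq> K" "length cs = length as" "eval cs x = eval as x \<oplus> eval bs x"
proof
  interpret K: subring K R by fact
  note KS = K.subset
  show "set (map2 (\<oplus>) as bs) \<subseteq> K"
    using assms(2,3) by (fastforce dest: set_zip_leftD set_zip_rightD intro: subringE(7)[OF assms(1)])
  show "length (map2 (\<oplus>) as bs) = length as" using assms(4) by simp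
  show "eval (map2 (\<oplus>) as bs) x = eval as x \<oplus> eval bs x"
    using assms(4,2,3)
  proof (induction as bs rule: list_induct2)
    case (Cons a as b bs)
    moreover have "set as \<subseteq> carrier R" "set bs \<subseteq> carrier R" "a \<in> carrier R" "b \<in> carrier R"
      using Cons.prems KS by auto
    ultimately show ?case using assms(5) by (simp add: eval_in_carrier l_distr a_ac)
  qed simp
qed

lemma (in cring) eval_scale:
  assumes "set cs \<subseteq> carrier R" "r \<in> carrier R" "x \<in> carrier R"
  shows "eval (map ((\<otimes>) r) cs) x = r \<otimes> eval cs x"
  using assms by (induction cs) (auto simp: eval_in_carrier r_distr m_assoc)

section \<open>Integrality in the total ring of fractions\<close>

context cring
begin

abbreviation "Q \<equiv> total_fractions R"
abbreviation "\<iota> \<equiv> frac_embed R"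

lemma embed_subring: "subring (\<iota> ` carrier R) Q"
proof -
  interpret Q: cring Q by (rule total_fractions_cring)
  interpret h: ring_hom_ring R Q \<iota>
    by (rule ring_hom_ringI2[OF ring_axioms Q.ring_axioms frac_embed_hom])
  show ?thesis using h.img_is_subring[OF carrier_is_subring] .
qed

lemma total_fractions_one_not_zero: "\<one> \<noteq> \<zero> \<Longrightarrow> \<one>\<^bsub>Q\<^esub> \<noteq> \<zero>\<^bsub>Q\<^esub>"
  by (simp add: fraction_simps)

lemma embed_regular_cancel:
  assumes "s \<in> regular_elements R" "x \<in> carrier Q" "y \<in> carrier Q"
    and "x \<otimes>\<^bsub>Q\<^esub> \<iota> s = y \<otimes>\<^bsub>Q\<^esub> \<iota> s"
  shows "x = y"
proof -
  interpret Q: cring Q by (rule total_fractions_cring)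
  have c: "\<iota> s \<in> carrier Q" "fraction R \<one> s \<in> carrier Q"
    using assms(1) by (auto simp: frac_embed_def fraction_simps)
  have "x \<otimes>\<^bsub>Q\<^esub> \<iota> s \<otimes>\<^bsub>Q\<^esub> fraction R \<one> s = y \<otimes>\<^bsub>Q\<^esub> \<iota> s \<otimes>\<^bsub>Q\<^esub> fraction R \<one> s"
    using assms(4) by simp
  then show ?thesis
    using assms(2,3) c frac_embed_regular_unit[OF assms(1)] by (simp add: Q.m_assoc)
qed

text \<open>The ideals \<open>J n\<close> of all \<open>r = p(y) s\<close> with \<open>deg p < n\<close> form an ascending chain; once it is
  stationary, \<open>y ^ n s = p(y) s\<close> and \<open>s\<close> cancels.\<close>

lemma integral_over_if_powers_bounded:
  assumes "noetherian_ring R" "\<one> \<noteq> \<zero>" and s: "s \<in> regular_elements R" and y: "y \<in> carrier Q"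
    and pow: "\<And>n::nat. y [^]\<^bsub>Q\<^esub> n \<otimes>\<^bsub>Q\<^esub> \<iota> s \<in> \<iota> ` carrier R"
  shows "integral_over Q (\<iota> ` carrier R) y"
proof -
  interpret N: noetherian_ring R by fact
  interpret Q: cring Q by (rule total_fractions_cring)
  interpret h: ring_hom_ring R Q \<iota>
    by (rule ring_hom_ringI2[OF ring_axioms Q.ring_axioms frac_embed_hom])
  interpret K: subring "\<iota> ` carrier R" Q by (rule embed_subring)
  let ?K = "\<iota> ` carrier R"
  have KQ: "?K \<subseteq> carrier Q" by (rule K.subset)
  have sQ: "\<iota> s \<in> carrier Q" using s regular_closed by simp
  define J where "J n = {r \<in> carrier R. \<exists>cs. set cs \<subseteq> ?K \<and> length cs = n
    \<and> \<iota> r = Q.eval cs y \<otimes>\<^bsub>Q\<^esub> \<iota> s}" for n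
  have JI: "r \<in> J (length cs)"
    if "r \<in> carrier R" "set cs \<subseteq> ?K" "\<iota> r = Q.eval cs y \<otimes>\<^bsub>Q\<^esub> \<iota> s" for r cs
    using that unfolding J_def by blast
  have JE: "\<exists>cs. r \<in> carrier R \<and> set cs \<subseteq> ?K \<and> set cs \<subseteq> carrier Q \<and> length cs = n
      \<and> Q.eval cs y \<in> carrier Q \<and> \<iota> r = Q.eval cs y \<otimes>\<^bsub>Q\<^esub> \<iota> s" if r: "r \<in> J n" for r n
  proof -
    obtain cs where "r \<in> carrier R" "set cs \<subseteq> ?K" "length cs = n" "\<iota> r = Q.eval cs y \<otimes>\<^bsub>Q\<^esub> \<iota> s"
      using r unfolding J_def by blast
    moreover have "set cs \<subseteq> carrier Q" using \<open>set cs \<subseteq> ?K\<close> KQ by (rule subset_trans)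
    ultimately show ?thesis using Q.eval_in_carrier[OF _ y] by metis
  qed
  have J_ideal: "ideal (J n) R" for n
  proof (rule idealI_left_multiples)
    show "J n \<subseteq> carrier R" by (auto simp: J_def)
    have "Q.eval (replicate n \<zero>\<^bsub>Q\<^esub>) y = \<zero>\<^bsub>Q\<^esub>"
      using Q.eval_replicate[of "[]" y n] y by simp
    moreover have "set (replicate n \<zero>\<^bsub>Q\<^esub>) \<subseteq> ?K"
      using subringE(2)[OF embed_subring] by auto
    ultimately show "\<zero> \<in> J n"
      using JI[of \<zero> "replicate n \<zero>\<^bsub>Q\<^esub>"] sQ by simp
    show "u \<oplus> v \<in> J n" if uv: "u \<in> J n" "v \<in> J n" for u v
    proof -
      obtain as where as: "u \<in> carrier R" "set as \<subseteq> ?K" "length as = n" "Q.eval as y \<in> carrier Q"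
            "\<iota> u = Q.eval as y \<otimes>\<^bsub>Q\<^esub> \<iota> s"
        using JE[OF uv(1)] by metis
      obtain bs where bs: "v \<in> carrier R" "set bs \<subseteq> ?K" "length bs = n" "Q.eval bs y \<in> carrier Q"
            "\<iota> v = Q.eval bs y \<otimes>\<^bsub>Q\<^esub> \<iota> s"
        using JE[OF uv(2)] by metis
      obtain cs where cs: "set cs \<subseteq> ?K" "length cs = length as"
        "Q.eval cs y = Q.eval as y \<oplus>\<^bsub>Q\<^esub> Q.eval bs y"
        using Q.eval_sum_ex[OF embed_subring as(2) bs(2) _ y] as(3) bs(3) by metis
      show ?thesis
        using JI[of "u \<oplus> v" cs] as bs cs sQ by (simp add: Q.l_distr)
    qed
    show "r \<otimes> u \<in> J n" if r: "r \<in> carrier R" and u: "u \<in> J n" for r u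
    proof -
      obtain as where as: "u \<in> carrier R" "set as \<subseteq> ?K" "set as \<subseteq> carrier Q" "length as = n"
        "Q.eval as y \<in> carrier Q" "\<iota> u = Q.eval as y \<otimes>\<^bsub>Q\<^esub> \<iota> s"
        using JE[OF u] by metis
      have "set (map ((\<otimes>\<^bsub>Q\<^esub>) (\<iota> r)) as) \<subseteq> ?K"
        using as(2) r subringE(6)[OF embed_subring] by auto
      then show ?thesis
        using JI[of "r \<otimes> u" "map ((\<otimes>\<^bsub>Q\<^esub>) (\<iota> r)) as"] as r sQ y
        by (simp add: Q.eval_scale Q.m_assoc)
    qed
  qed
  \<comment> \<open>A maximal member \<open>J n\<close> gives stationarity: prepending a zero
    coefficient shows \<open>J n \<subseteq> J (Suc n)\<close>, so the two agree.\<close>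
  obtain M where M: "M \<in> range J" and max: "\<And>I. I \<in> range J \<Longrightarrow> M \<subseteq> I \<Longrightarrow> I = M"
    by (rule N.ideal_family_has_maximal[of "range J"]) (use J_ideal in auto)
  then obtain n where n: "M = J n" by blast
  have "J n \<subseteq> J (Suc n)"
  proof
    fix r assume "r \<in> J n"
    then obtain cs where cs: "r \<in> carrier R" "set cs \<subseteq> ?K" "length cs = n"
      "Q.eval cs y \<in> carrier Q" "\<iota> r = Q.eval cs y \<otimes>\<^bsub>Q\<^esub> \<iota> s"
      using JE by metis
    then show "r \<in> J (Suc n)"
      using JI[of r "\<zero>\<^bsub>Q\<^esub> # cs"] subringE(2)[OF embed_subring] y by simp
  qed
  then have stat: "J (Suc n) = J n" using max[of "J (Suc n)"] n by blast
  obtain r where r: "r \<in> carrier R" "\<iota> r = y [^]\<^bsub>Q\<^esub> n \<otimes>\<^bsub>Q\<^esub> \<iota> s"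
    using pow[of n] by (metis imageE)
  \<comment> \<open>The coefficient list of the monomial of degree \<open>n\<close> has length
    \<open>Suc n\<close>, so it puts \<open>r\<close> into \<open>J (Suc n)\<close>; stationarity
    then supplies a list of length \<open>n\<close> for the same \<open>r\<close>.\<close>
  let ?xn = "\<one>\<^bsub>Q\<^esub> # replicate n \<zero>\<^bsub>Q\<^esub>"
  have "Q.eval ?xn y = y [^]\<^bsub>Q\<^esub> n"
    using Q.eval_replicate[of "[]" y n] y by simp
  moreover have "set ?xn \<subseteq> ?K"
    using subringE(2,3)[OF embed_subring] by auto
  ultimately have "r \<in> J (Suc n)"
    using JI[of r ?xn] r by simp
  then obtain cs where cs: "set cs \<subseteq> ?K" "length cs = n"
      "Q.eval cs y \<in> carrier Q" "\<iota> r = Q.eval cs y \<otimes>\<^bsub>Q\<^esub> \<iota> s"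
    using JE[of r n] stat by metis
  then have "y [^]\<^bsub>Q\<^esub> n = Q.eval cs y"
    using embed_regular_cancel[OF s] y r(2) by simp
  then show ?thesis
    using integral_over_iff[OF total_fractions_cring embed_subring
        total_fractions_one_not_zero[OF assms(2)] y] cs by blast
qed

lemma mem_normalization_iff:
  "y \<in> carrier (normalization R) \<longleftrightarrow> y \<in> carrier Q \<and> integral_over Q (\<iota> ` carrier R) y"
  by (simp add: normalization_def)

lemma normalization_sel:
  "mult (normalization R) = mult Q" "one (normalization R) = one Q"
  "add (normalization R) = add Q" "smult (normalization R) = smult Q"
  by (simp_all add: normalization_def)

lemma one_in_normalization:
  assumes "\<one> \<noteq> \<zero>"
  shows "\<one>\<^bsub>Q\<^esub> \<in> carrier (normalization R)"
proof -
  interpret Q: cring Q by (rule total_fractions_cring)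
  \<comment> \<open>The one-entry list encodes the monic equation \<open>X = 1\<close>.\<close>
  have "\<exists>cs. set cs \<subseteq> \<iota> ` carrier R \<and> \<one>\<^bsub>Q\<^esub> [^]\<^bsub>Q\<^esub> length cs = Q.eval cs \<one>\<^bsub>Q\<^esub>"
    using subringE(3)[OF embed_subring] by (intro exI[of _ "[\<one>\<^bsub>Q\<^esub>]"]) simp
  then show ?thesis
    using integral_over_iff[OF total_fractions_cring embed_subring
        total_fractions_one_not_zero[OF assms] Q.one_closed]
    by (simp add: mem_normalization_iff)
qed

end

section \<open>Integral multipliers of the maximal ideal\<close>

context local_ring
begin

lemma one_not_zero: "\<one> \<noteq> \<zero>"
  using I_notcarr one_imp_carrier zero_closed by metis

lemma embed_ring_hom: "ring_hom_ring R Q \<iota>"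
  using ring_hom_ringI2[OF ring_axioms cring.axioms(1)[OF total_fractions_cring] frac_embed_hom] .

text \<open>If \<open>u = x y\<close>, multiplying an integral equation of degree \<open>n\<close> for \<open>y\<close> by \<open>x ^ n\<close>
  puts \<open>u ^ n\<close> into \<open>x R\<close>.\<close>

lemma maximal_ideal_times_integral:
  assumes x: "x \<in> \<mm>" and y: "y \<in> carrier (normalization R)" and u: "u \<in> carrier R"
    and xy: "\<iota> u = \<iota> x \<otimes>\<^bsub>Q\<^esub> y"
  shows "u \<in> \<mm>"
proof -
  interpret Q: cring Q by (rule total_fractions_cring)
  interpret h: ring_hom_ring R Q \<iota> by (rule embed_ring_hom)
  have yQ: "y \<in> carrier Q" using y by (simp add: mem_normalization_iff)
  have xR: "x \<in> carrier R" and xQ: "\<iota> x \<in> carrier Q" using x by auto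
  \<comment> \<open>The evaluated polynomial has degree below \<open>length cs\<close>, so each
    power of \<open>y\<close> is absorbed into a power of \<open>u\<close> with at least one factor
    \<open>x\<close> left over. That factor keeps every term in \<open>\<mm>\<close>.\<close>
  have scaled: "\<iota> x [^]\<^bsub>Q\<^esub> length cs \<otimes>\<^bsub>Q\<^esub> Q.eval cs y \<in> \<iota> ` \<mm>" if "set cs \<subseteq> \<iota> ` carrier R" for cs
    using that
  proof (induction cs)
    case Nil
    then show ?case using h.hom_zero zero_closed by (metis Q.eval.simps(1) Q.nat_pow_closed Q.r_null xQ imageI)
  next
    case (Cons c cs)
    then obtain c' v where c': "c = \<iota> c'" "c' \<in> carrier R"
      and v: "v \<in> \<mm>" "\<iota> x [^]\<^bsub>Q\<^esub> length cs \<otimes>\<^bsub>Q\<^esub> Q.eval cs y = \<iota> v" by auto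
    let ?k = "length cs"
    have cQ: "c \<in> carrier Q" using c' by simp
    have eQ: "Q.eval cs y \<in> carrier Q"
      using Cons.prems subringE(1)[OF embed_subring] yQ by (intro Q.eval_in_carrier) auto
    have "\<iota> x [^]\<^bsub>Q\<^esub> Suc ?k \<otimes>\<^bsub>Q\<^esub> (c \<otimes>\<^bsub>Q\<^esub> y [^]\<^bsub>Q\<^esub> ?k \<oplus>\<^bsub>Q\<^esub> Q.eval cs y)
        = c \<otimes>\<^bsub>Q\<^esub> \<iota> x \<otimes>\<^bsub>Q\<^esub> (\<iota> x [^]\<^bsub>Q\<^esub> ?k \<otimes>\<^bsub>Q\<^esub> y [^]\<^bsub>Q\<^esub> ?k)
          \<oplus>\<^bsub>Q\<^esub> \<iota> x \<otimes>\<^bsub>Q\<^esub> (\<iota> x [^]\<^bsub>Q\<^esub> ?k \<otimes>\<^bsub>Q\<^esub> Q.eval cs y)"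
      using xQ yQ cQ eQ by (simp add: Q.r_distr Q.m_ac)
    also have "\<iota> x [^]\<^bsub>Q\<^esub> ?k \<otimes>\<^bsub>Q\<^esub> y [^]\<^bsub>Q\<^esub> ?k = \<iota> u [^]\<^bsub>Q\<^esub> ?k"
      using xQ yQ xy by (simp add: Q.nat_pow_distrib)
    also have "c \<otimes>\<^bsub>Q\<^esub> \<iota> x \<otimes>\<^bsub>Q\<^esub> \<iota> u [^]\<^bsub>Q\<^esub> ?k
        \<oplus>\<^bsub>Q\<^esub> \<iota> x \<otimes>\<^bsub>Q\<^esub> (\<iota> x [^]\<^bsub>Q\<^esub> ?k \<otimes>\<^bsub>Q\<^esub> Q.eval cs y)
        = \<iota> (c' \<otimes> x \<otimes> u [^] ?k \<oplus> x \<otimes> v)"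
      using c' xR u v by (simp add: h.hom_nat_pow)
    also have "\<dots> \<in> \<iota> ` \<mm>"
      using x v(1) c'(2) u xR by (intro imageI a_closed I_r_closed I_l_closed) auto
    finally show ?case by simp
  qed
  obtain cs where cs: "set cs \<subseteq> \<iota> ` carrier R" "y [^]\<^bsub>Q\<^esub> length cs = Q.eval cs y"
    using y integral_over_iff[OF total_fractions_cring embed_subring
        total_fractions_one_not_zero[OF one_not_zero] yQ]
    by (auto simp: mem_normalization_iff)
  have "\<iota> (u [^] length cs) = \<iota> x [^]\<^bsub>Q\<^esub> length cs \<otimes>\<^bsub>Q\<^esub> Q.eval cs y"
    using u xy xQ yQ by (simp add: h.hom_nat_pow Q.nat_pow_distrib flip: cs(2))
  then have "\<iota> (u [^] length cs) \<in> \<iota> ` \<mm>" using scaled[OF cs(1)] by simp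
  then have power: "u [^] length cs \<in> \<mm>"
    using inj_on_image_mem_iff[OF frac_embed_inj _ a_subset] u by simp
  interpret P: primeideal \<mm> R by (rule maximalideal_prime[OF is_maximalideal])
  have "u \<in> \<mm>" if "u [^] n \<in> \<mm>" for n :: nat
    using that
  proof (induction n)
    \<comment> \<open>Exponent zero would put \<open>\<one>\<close> into \<open>\<mm>\<close>,
      making \<open>\<mm>\<close> the whole ring, \<open>u\<close> included.\<close>
    case 0
    then show ?case using one_imp_carrier u by simp
  next
    case (Suc n)
    then show ?case using P.I_prime[of "u [^] n" u] u by auto
  qed
  then show ?thesis using power by blast
qed

text \<open>Iterating \<open>stable\<close> keeps every power of \<open>y\<close> times
  \<open>s\<close> inside \<open>\<mm>\<close>, so \<open>s\<close> is a common denominator of all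
  powers and \<open>integral_over_if_powers_bounded\<close> applies. This takes the place of the
  determinant trick.\<close>

lemma multiplier_in_normalization:
  assumes "noetherian_ring R" and s: "s \<in> \<mm>" "s \<in> regular_elements R" and y: "y \<in> carrier Q"
    and stable: "\<And>x. x \<in> \<mm> \<Longrightarrow> y \<otimes>\<^bsub>Q\<^esub> \<iota> x \<in> \<iota> ` \<mm>"
  shows "y \<in> carrier (normalization R)"
proof -
  interpret Q: cring Q by (rule total_fractions_cring)
  interpret h: ring_hom_ring R Q \<iota> by (rule embed_ring_hom)
  have "y [^]\<^bsub>Q\<^esub> n \<otimes>\<^bsub>Q\<^esub> \<iota> s \<in> \<iota> ` \<mm>" for n :: nat
  proof (induction n)
    case 0
    then show ?case using s(1) by simp
  next
    case (Suc n)
    then obtain v where v: "v \<in> \<mm>" "y [^]\<^bsub>Q\<^esub> n \<otimes>\<^bsub>Q\<^esub> \<iota> s = \<iota> v" by blast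
    have "y [^]\<^bsub>Q\<^esub> Suc n \<otimes>\<^bsub>Q\<^esub> \<iota> s = y \<otimes>\<^bsub>Q\<^esub> (y [^]\<^bsub>Q\<^esub> n \<otimes>\<^bsub>Q\<^esub> \<iota> s)"
      using y s(1) by (simp add: Q.m_ac)
    then show ?case using stable[OF v(1)] v(2) by simp
  qed
  then have "y [^]\<^bsub>Q\<^esub> n \<otimes>\<^bsub>Q\<^esub> \<iota> s \<in> \<iota> ` carrier R" for n :: nat
    using a_subset by blast
  then show ?thesis
    using integral_over_if_powers_bounded[OF assms(1) one_not_zero s(2) y] y
    by (simp add: mem_normalization_iff)
qed

section \<open>The endomorphism ring of the maximal ideal\<close>

abbreviation "E \<equiv> module_End R (ideal_module R \<mm>)"

lemma mem_End_iff:
  "f \<in> carrier E \<longleftrightarrow> f \<in> \<mm> \<rightarrow>\<^sub>E \<mm> \<and> (\<forall>x \<in> \<mm>. \<forall>y \<in> \<mm>. f (x \<oplus> y) = f x \<oplus> f y)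
     \<and> (\<forall>r \<in> carrier R. \<forall>x \<in> \<mm>. f (r \<otimes> x) = r \<otimes> f x)"
  by (simp add: module_End_def ideal_module_def)

lemma End_sel:
  "mult E f g = compose \<mm> f g" "one E = (\<lambda>x \<in> \<mm>. x)"
  "add E f g = (\<lambda>x \<in> \<mm>. f x \<oplus> g x)" "smult E r f = (\<lambda>x \<in> \<mm>. r \<otimes> f x)"
  by (simp_all add: module_End_def ideal_module_def)

text \<open>An element \<open>a/s\<close> is determined by \<open>s (a/s) = a\<close>, so \<open>R\<close>-linearity forces any algebra
  homomorphism into the endomorphisms to send it to multiplication by \<open>a/s\<close>.\<close>

lemma one_step_normal_imp_conductor:
  assumes "one_step_normal R \<mm>"
  shows "\<iota> ` \<mm> \<subseteq> conductor R"
proof -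
  interpret h: ring_hom_ring R Q \<iota> by (rule embed_ring_hom)
  obtain h where iso: "h \<in> ring_iso (normalization R) E"
    and lin: "\<And>r x. r \<in> carrier R \<Longrightarrow> x \<in> carrier (normalization R)
      \<Longrightarrow> h (r \<odot>\<^bsub>Q\<^esub> x) = r \<odot>\<^bsub>E\<^esub> h x"
    using assms by (auto simp: one_step_normal_def algebra_iso_def normalization_sel)
  have h_one: "h \<one>\<^bsub>Q\<^esub> = (\<lambda>x \<in> \<mm>. x)"
    using ring_iso_memE(4)[OF iso] by (simp add: normalization_sel End_sel)
  have "\<iota> x \<otimes>\<^bsub>Q\<^esub> y \<in> \<iota> ` carrier R" if x: "x \<in> \<mm>" and y: "y \<in> carrier (normalization R)" for x y
  proof -
    have xR: "x \<in> carrier R" using x by simp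
    obtain a s where as: "a \<in> carrier R" "s \<in> regular_elements R" "y = fraction R a s"
      using y by (metis mem_normalization_iff total_fractions_cases)
    have sR: "s \<in> carrier R" using as(2) by (rule regular_closed)
    have "h y \<in> carrier E" using ring_iso_memE(1)[OF iso y] .
    then have hR: "h y x \<in> carrier R" using x a_subset by (auto simp: mem_End_iff)
    have "s \<odot>\<^bsub>Q\<^esub> y = a \<odot>\<^bsub>Q\<^esub> \<one>\<^bsub>Q\<^esub>"
      using as sR by (simp add: fraction_simps m_ac)
    then have "s \<odot>\<^bsub>E\<^esub> h y = a \<odot>\<^bsub>E\<^esub> (\<lambda>x \<in> \<mm>. x)"
      using lin[OF sR y] lin[OF as(1) one_in_normalization[OF one_not_zero]] h_one by simp
    then have "(s \<odot>\<^bsub>E\<^esub> h y) x = (a \<odot>\<^bsub>E\<^esub> (\<lambda>x \<in> \<mm>. x)) x" by simp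
    then have "s \<otimes> h y x = a \<otimes> x" using x by (simp add: End_sel)
    then have "\<iota> x \<otimes>\<^bsub>Q\<^esub> y = \<iota> (h y x)"
      using as sR xR hR by (simp add: frac_embed_def fraction_simps m_ac)
    then show ?thesis using hR by blast
  qed
  then show ?thesis using a_subset h.hom_closed by (auto simp: conductor_def)
qed

text \<open>The isomorphism sends \<open>y\<close> to multiplication by \<open>y\<close> on
  \<open>\<mm>\<close>. The regular element \<open>s\<close> serves both for injectivity and as the
  denominator that recovers \<open>y\<close> from an endomorphism.\<close>

lemma conductor_imp_one_step_normal:
  assumes noeth: "noetherian_ring R" and s: "s \<in> \<mm>" "s \<in> regular_elements R"
    and sub: "\<iota> ` \<mm> \<subseteq> conductor R"
  shows "one_step_normal R \<mm>"
proof -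
  interpret Q: cring Q by (rule total_fractions_cring)
  interpret h: ring_hom_ring R Q \<iota> by (rule embed_ring_hom)
  note mR = subsetD[OF a_subset]
  have sR: "s \<in> carrier R" using s(1) by simp
  \<comment> \<open>The product is formed in \<open>Q\<close> and pulled back along the injective
    \<open>\<iota>\<close>; restricting to \<open>\<mm>\<close> makes the map extensional, as the
    carrier of \<open>E\<close> demands.\<close>
  define h where "h y = (\<lambda>x \<in> \<mm>. inv_into (carrier R) \<iota> (y \<otimes>\<^bsub>Q\<^esub> \<iota> x))" for y
  have hI: "h y x = u" if "x \<in> \<mm>" "u \<in> carrier R" "\<iota> u = y \<otimes>\<^bsub>Q\<^esub> \<iota> x" for x y u
    using that inv_into_f_f[OF frac_embed_inj] unfolding h_def by (simp flip: that(3))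
  have N_Q: "y \<in> carrier Q" if "y \<in> carrier (normalization R)" for y
    using that by (simp add: mem_normalization_iff)
  have h: "h y x \<in> \<mm>" "\<iota> (h y x) = y \<otimes>\<^bsub>Q\<^esub> \<iota> x"
    if y: "y \<in> carrier (normalization R)" and x: "x \<in> \<mm>" for x y
  proof -
    have comm: "y \<otimes>\<^bsub>Q\<^esub> \<iota> x = \<iota> x \<otimes>\<^bsub>Q\<^esub> y" using N_Q[OF y] mR[OF x] by (simp add: Q.m_comm)
    \<comment> \<open>The conductor only places the product in \<open>R\<close>; integrality of
      \<open>y\<close> then moves it into \<open>\<mm>\<close>.\<close>
    obtain u where u: "u \<in> carrier R" "\<iota> u = \<iota> x \<otimes>\<^bsub>Q\<^esub> y"
      using sub x y unfolding conductor_def by (metis (no_types, lifting) image_iff mem_Collect_eq subsetD imageI)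
    have "h y x = u" using hI[OF x u(1)] u(2) comm by simp
    then show "h y x \<in> \<mm>" "\<iota> (h y x) = y \<otimes>\<^bsub>Q\<^esub> \<iota> x"
      using maximal_ideal_times_integral[OF x y u] u(2) comm by auto
  qed
  \<comment> \<open>This reduces each homomorphism law for \<open>h\<close> to an identity in
    \<open>Q\<close>: it suffices that the other side also acts as multiplication by
    \<open>y\<close>.\<close>
  have h_ext: "h y = f" if "f \<in> extensional \<mm>" "\<And>x. x \<in> \<mm> \<Longrightarrow> f x \<in> carrier R"
    "\<And>x. x \<in> \<mm> \<Longrightarrow> \<iota> (f x) = y \<otimes>\<^bsub>Q\<^esub> \<iota> x" for f y
    by (rule extensionalityI[of _ \<mm>]) (use that hI in \<open>auto simp: h_def\<close>)
  have closed: "h y \<in> carrier E" if y: "y \<in> carrier (normalization R)" for y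
    unfolding mem_End_iff
  proof (intro conjI ballI)
    note [simp] = N_Q[OF y]
    show "h y \<in> \<mm> \<rightarrow>\<^sub>E \<mm>" using h(1)[OF y] by (auto simp: h_def)
    show "h y (x \<oplus> z) = h y x \<oplus> h y z" if "x \<in> \<mm>" "z \<in> \<mm>" for x z
      using that h[OF y] mR by (intro hI) (auto simp: Q.r_distr)
    show "h y (r \<otimes> x) = r \<otimes> h y x" if "r \<in> carrier R" "x \<in> \<mm>" for r x
      using that h[OF y] mR by (intro hI) (auto simp: Q.m_lcomm I_l_closed)
  qed
  have "bij_betw h (carrier (normalization R)) (carrier E)"
  proof (rule bij_betw_imageI[OF inj_onI subset_antisym[OF image_subsetI subsetI]])
    \<comment> \<open>Comparing the values at \<open>s\<close> suffices, because \<open>s\<close> is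
      invertible in \<open>Q\<close>.\<close>
    show "y = z" if "y \<in> carrier (normalization R)" "z \<in> carrier (normalization R)" "h y = h z" for y z
      using embed_regular_cancel[OF s(2)] h(2)[OF that(1) s(1)] h(2)[OF that(2) s(1)] that N_Q by metis
    show "h y \<in> carrier E" if "y \<in> carrier (normalization R)" for y
      using that by (rule closed)
    show "f \<in> h ` carrier (normalization R)" if f: "f \<in> carrier E" for f
    proof -
      define y where "y = fraction R (f s) s"
      have fm: "f x \<in> \<mm>" if "x \<in> \<mm>" for x using f that by (auto simp: mem_End_iff)
      have yQ: "y \<in> carrier Q" using fm[OF s(1)] s(2) mR by (simp add: y_def fraction_closed)
      have yf: "\<iota> (f x) = y \<otimes>\<^bsub>Q\<^esub> \<iota> x" if x: "x \<in> \<mm>" for x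
      proof -
        \<comment> \<open>Linearity evaluates \<open>f (x \<otimes> s)\<close> in two ways, as
          \<open>s \<otimes> f x\<close> and as \<open>x \<otimes> f s\<close>; dividing by
          \<open>s\<close> shows that \<open>f\<close> is multiplication by
          \<open>y\<close>.\<close>
        have "s \<otimes> f x = f (x \<otimes> s)" using f x sR mR by (simp add: mem_End_iff m_comm)
        also have "\<dots> = x \<otimes> f s" using f x s(1) mR by (simp add: mem_End_iff)
        finally show ?thesis
          using s(2) sR mR[OF x] mR[OF fm[OF x]] mR[OF fm[OF s(1)]]
          by (simp add: y_def frac_embed_def fraction_simps m_ac)
      qed
      have "y \<in> carrier (normalization R)"
        using multiplier_in_normalization[OF noeth s yQ] yf fm by (metis imageI)
      moreover have "h y = f"
        using f fm mR yf by (intro h_ext) (auto simp: mem_End_iff PiE_def)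
      ultimately show ?thesis by blast
    qed
  qed
  moreover have "h (x \<otimes>\<^bsub>Q\<^esub> y) = h x \<otimes>\<^bsub>E\<^esub> h y" "h (x \<oplus>\<^bsub>Q\<^esub> y) = h x \<oplus>\<^bsub>E\<^esub> h y"
    if "x \<in> carrier (normalization R)" "y \<in> carrier (normalization R)" for x y
    using that h mR N_Q
    by (auto intro!: h_ext simp: End_sel compose_def Q.m_assoc Q.l_distr)
  moreover have "h \<one>\<^bsub>Q\<^esub> = \<one>\<^bsub>E\<^esub>"
    using mR by (auto intro!: h_ext simp: End_sel)
  ultimately have "h \<in> ring_iso (normalization R) E"
    using closed by (intro ring_iso_memI) (simp_all add: normalization_sel)
  moreover have "h (r \<odot>\<^bsub>Q\<^esub> y) = r \<odot>\<^bsub>E\<^esub> h y"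
    if r: "r \<in> carrier R" and y: "y \<in> carrier (normalization R)" for r y
  proof -
    obtain a t where "a \<in> carrier R" "t \<in> regular_elements R" "y = fraction R a t"
      using N_Q[OF y] by (rule total_fractions_cases)
    \<comment> \<open>On a representative the scalar action is multiplication by
      \<open>\<iota> r\<close>, which reduces linearity to associativity in
      \<open>Q\<close>.\<close>
    then have "r \<odot>\<^bsub>Q\<^esub> y = \<iota> r \<otimes>\<^bsub>Q\<^esub> y"
      using r by (simp add: frac_embed_def fraction_simps)
    then show ?thesis
      using r h[OF y] mR N_Q[OF y] by (auto intro!: h_ext simp: End_sel Q.m_assoc)
  qed
  ultimately show ?thesis
    by (auto simp: one_step_normal_def algebra_iso_def normalization_sel)
qed

end

theorem proposition4p2:
  fixes R :: "('a, 'b) ring_scheme" and \<mm> :: "'a set"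
  assumes "local_ring R \<mm>"
    and "noetherian_ring R"
    and "reduced_ring R"
    and "krull_dim R = 1"
    and "fin_gen_module R (normalization R)"
  shows "frac_embed R ` \<mm> \<subseteq> conductor R \<longleftrightarrow> one_step_normal R \<mm>"
proof -
  interpret local_ring R \<mm> by fact
  show ?thesis
    \<comment> \<open>Reducedness and dimension one enter through the regular element of
      \<open>\<mm>\<close>, the denominator in the passage from the conductor to the
      isomorphism.\<close>
    using maximal_ideal_has_regular[OF assms(2-4)] one_step_normal_imp_conductor
      conductor_imp_one_step_normal[OF assms(2)] by blast
qed

end
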